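(* Let $\pi/2\leq\delta<\pi$. If $f\in\mathcal{A}$ belongs to the class $\mathcal{M}(\delta)$, then the logarithmic coefficients $\gamma_n$ of $f$ satisfy $$|\gamma_n|\leq\frac{1}{2n}\quad\text{for all integers } n\geq1.$$
   Context: $\Delta=\{z\in\mathbb{C}:|z|<1\}$ is the open unit disc. $\mathcal{A}$ is the class of functions $f$ analytic in $\Delta$ with $f(0)=0$ and $f'(0)=1$. For $\pi/2\le\delta<\pi$, $\mathcal{M}(\delta)$ is the class of all $f\in\mathcal{A}$ such that $$1+\frac{\delta-\pi}{2\sin\delta}<\mathrm{Re}\left\{\frac{zf'(z)}{f(z)}\right\}<1+\frac{\delta}{2\sin\delta}\quad(z\in\Delta).$$ Here $zf'(z)/f(z)$ is analytic in $\Delta$ with value $1$ at $z=0$; in particular $f(z)\neq0$ for $z\in\Delta\setminus\{0\}$. The logarithmic coefficients $\gamma_n=\gamma_n(f)$ ($n\ge1$) of such an $f$ are defined by $$\log\left\{\frac{f(z)}{z}\right\}=\sum_{n=1}^{\infty}2\gamma_n z^n\quad(z\in\Delta),$$ where $f(z)/z$ has value $1$ at $z=0$ and $\log\{f(z)/z\}$ is its analytic logarithm on $\Delta$ vanishing at $z=0$. *)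

theory Defs
  imports "HOL-Complex_Analysis.Complex_Analysis"
begin

definition unit_disc :: "complex set" where
  "unit_disc = {z. norm z < 1}"

definition class_A :: "(complex \<Rightarrow> complex) set" where
  "class_A = {f. f holomorphic_on unit_disc \<and> f 0 = 0 \<and> deriv f 0 = 1}"

text \<open>The function \<open>z f'(z) / f(z)\<close>, with its removable singularity at \<open>0\<close> filled in:
  for \<open>f\<close> in \<^const>\<open>class_A\<close> the value there is \<open>1\<close>, whereas HOL division would give \<open>0\<close>.\<close>

definition zdf_over_f :: "(complex \<Rightarrow> complex) \<Rightarrow> complex \<Rightarrow> complex" where
  "zdf_over_f f z = (if z = 0 then 1 else z * deriv f z / f z)"

text \<open>Since \<open>x / 0 = 0\<close> in HOL, the implicit requirement that \<open>z f'(z) / f(z)\<close> be defined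
  on the punctured disc has to be stated explicitly.\<close>

definition class_M :: "real \<Rightarrow> (complex \<Rightarrow> complex) set" where
  "class_M \<delta> = {f \<in> class_A.
     (\<forall>z \<in> unit_disc - {0}. f z \<noteq> 0) \<and>
     (\<forall>z \<in> unit_disc.
        1 + (\<delta> - pi) / (2 * sin \<delta>) < Re (zdf_over_f f z) \<and>
        Re (zdf_over_f f z) < 1 + \<delta> / (2 * sin \<delta>))}"

text \<open>\<open>g\<close> is the analytic logarithm of \<open>f(z) / z\<close> (with value \<open>1\<close> at \<open>0\<close>) on the disc that
  vanishes at \<open>0\<close>. The principal branch \<^const>\<open>Ln\<close> is not used, because \<open>f(z) / z\<close>
  is not known in advance to avoid the negative real axis.\<close>

definition is_log_f_over_z :: "(complex \<Rightarrow> complex) \<Rightarrow> (complex \<Rightarrow> complex) \<Rightarrow> bool" where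
  "is_log_f_over_z f g \<longleftrightarrow>
     g holomorphic_on unit_disc \<and> g 0 = 0 \<and>
     (\<forall>z \<in> unit_disc. exp (g z) = (if z = 0 then 1 else f z / z))"

text \<open>\<open>\<gamma> n\<close> is the \<open>n\<close>-th logarithmic coefficient for \<open>n \<ge> 1\<close>; the series starts at \<open>n = 1\<close>
  (hence the shift by \<^const>\<open>Suc\<close>) and \<open>\<gamma> 0\<close> is irrelevant.\<close>

definition log_coeffs :: "(complex \<Rightarrow> complex) \<Rightarrow> (nat \<Rightarrow> complex) \<Rightarrow> bool" where
  "log_coeffs f \<gamma> \<longleftrightarrow>
     (\<exists>g. is_log_f_over_z f g \<and>
        (\<forall>z \<in> unit_disc. (\<lambda>n. 2 * \<gamma> (Suc n) * z ^ Suc n) sums g z))"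

text \<open>The logarithmic coefficients exist and are unique.\<close>

lemma log_coeffs_exist:
  assumes "f \<in> class_A" and nz: "\<And>z. z \<in> unit_disc - {0} \<Longrightarrow> f z \<noteq> 0"
  shows "\<exists>\<gamma>. log_coeffs f \<gamma>"
proof -
  have disc: "unit_disc = ball 0 1" by (auto simp: unit_disc_def)
  define h where "h = (\<lambda>z. if z = 0 then 1 else f z / z)"
  have f: "f holomorphic_on ball 0 1" "f 0 = 0" "deriv f 0 = 1"
    using assms(1) by (auto simp: class_A_def disc)
  have h: "h holomorphic_on ball 0 1"
    by (rule pole_theorem_open_0[OF f(1), of 0]) (auto simp: h_def f)
  have hnz: "h z \<noteq> 0" if "z \<in> ball 0 1" for z
    using nz[of z] that by (auto simp: h_def disc)
  obtain g0 where g0: "g0 holomorphic_on ball 0 1"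
      "\<And>z. z \<in> ball 0 1 \<Longrightarrow> h z = exp (g0 z)"
    using contractible_imp_holomorphic_log[OF h convex_imp_contractible[OF convex_ball] hnz]
    by blast
  define g where "g = (\<lambda>z. g0 z - g0 0)"
  have e0: "exp (g0 0) = 1" using g0(2)[of 0] by (simp add: h_def)
  have g: "g holomorphic_on ball 0 1" "g 0 = 0"
    using g0(1) by (auto simp: g_def intro!: holomorphic_intros)
  have "exp (g z) = h z" if "z \<in> ball 0 1" for z
    using g0(2)[OF that] e0 by (simp add: g_def exp_diff)
  then have lg: "is_log_f_over_z f g"
    using g by (auto simp: is_log_f_over_z_def disc h_def)
  define \<gamma> where "\<gamma> n = (deriv ^^ n) g 0 / fact n / 2" for n
  have "(\<lambda>n. 2 * \<gamma> (Suc n) * z ^ Suc n) sums g z" if "z \<in> unit_disc" for z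
  proof -
    have "(\<lambda>n. 2 * \<gamma> n * z ^ n) sums g z"
      using holomorphic_power_series[OF g(1), of z] that by (simp add: disc \<gamma>_def)
    moreover have "\<gamma> 0 = 0" by (simp add: \<gamma>_def g)
    ultimately show ?thesis
      by (subst sums_Suc_iff) simp
  qed
  with lg show ?thesis by (auto simp: log_coeffs_def)
qed

lemma log_coeffs_unique:
  assumes "log_coeffs f \<gamma>" "log_coeffs f \<gamma>'" "n \<ge> 1"
  shows "\<gamma> n = \<gamma>' n"
proof (rule ccontr)
  assume ne: "\<gamma> n \<noteq> \<gamma>' n"
  have disc: "unit_disc = ball 0 1" by (auto simp: unit_disc_def)
  obtain g g' where g: "is_log_f_over_z f g" "is_log_f_over_z f g'"
    and s: "\<And>z. z \<in> unit_disc \<Longrightarrow> (\<lambda>n. 2 * \<gamma> (Suc n) * z ^ Suc n) sums g z"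
           "\<And>z. z \<in> unit_disc \<Longrightarrow> (\<lambda>n. 2 * \<gamma>' (Suc n) * z ^ Suc n) sums g' z"
    using assms(1,2) unfolding log_coeffs_def by blast
  define d where "d = (\<lambda>z. g z - g' z)"
  define a where "a n = (if n = 0 then 0 else 2 * (\<gamma> n - \<gamma>' n))" for n
  have sd: "(\<lambda>n. a n * (z - 0) ^ n) sums d z" if "norm (z - 0) < 1" for z
  proof -
    have "(\<lambda>n. 2 * \<gamma> (Suc n) * z ^ Suc n - 2 * \<gamma>' (Suc n) * z ^ Suc n) sums d z"
      unfolding d_def using that by (intro sums_diff s) (auto simp: disc)
    also have "(\<lambda>n. 2 * \<gamma> (Suc n) * z ^ Suc n - 2 * \<gamma>' (Suc n) * z ^ Suc n)
             = (\<lambda>n. a (Suc n) * z ^ Suc n)"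
      by (auto simp: a_def algebra_simps)
    finally show ?thesis
      by (subst (asm) sums_Suc_iff) (simp add: a_def)
  qed
  have d0: "d 0 = 0" using g by (simp add: d_def is_log_f_over_z_def)
  have "a n \<noteq> 0" using ne assms(3) by (simp add: a_def)
  then obtain r where r: "r > 0" "\<And>z. z \<in> cball 0 r - {0} \<Longrightarrow> d z \<noteq> 0"
    using powser_0_nonzero[OF zero_less_one sd d0, of n] assms(3) by (metis One_nat_def Suc_le_eq)
  have "d holomorphic_on ball 0 1"
    using g unfolding d_def is_log_f_over_z_def disc by (intro holomorphic_intros) auto
  then have "continuous_on (ball 0 1) d" by (rule holomorphic_on_imp_continuous_on)
  then have "isCont d 0" by (simp add: continuous_on_eq_continuous_at)
  then obtain e where e: "e > 0" "\<And>z. norm z < e \<Longrightarrow> norm (d z) < 1"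
    using d0 by (auto simp: continuous_at_eps_delta dest: spec[of _ 1])
  define t where "t = Min {r, e / 2, 1 / 2}"
  have t: "t > 0" "t \<le> r" "t < e" "t < 1" using r(1) e(1) by (auto simp: t_def)
  define z where "z = complex_of_real t"
  have z: "z \<noteq> 0" "norm z \<le> r" "norm z < e" "z \<in> unit_disc"
    using t by (auto simp: z_def unit_disc_def)
  have "exp (g z) = exp (g' z)" using g z(4) by (auto simp: is_log_f_over_z_def)
  then have "exp (d z) = exp 0" by (simp add: d_def exp_diff)
  moreover have "\<bar>Im (d z) - Im 0\<bar> < 2 * pi"
    using e(2)[OF z(3)] abs_Im_le_cmod[of "d z"] pi_gt3 by simp
  ultimately have "d z = 0" using exp_complex_eqI[of "d z" 0] by simp
  with r(2)[of z] z show False by auto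
qed

end

theory Submission
  imports Defs
begin

text \<open>If \<open>g(z) = \<Sum> 2 \<gamma>\<^sub>n z\<^sup>n\<close> is the logarithm of \<open>f(z)/z\<close>, then
  \<open>p(z) = z g'(z) = z f'(z)/f(z) - 1 = \<Sum> 2 n \<gamma>\<^sub>n z\<^sup>n\<close> maps the disc into a vertical strip, which is
  convex. Averaging \<open>p\<close> over the rotations by the \<open>n\<close>-th roots of unity (Rogosinski) shows that
  \<open>F(w) = \<Sum> 2 n k \<gamma>\<^bsub>nk\<^esub> w\<^sup>k\<close> maps the disc into the same strip. The function \<open>exp (2 \<i> sin \<delta> F)\<close>
  then maps the disc into a half-plane; composing with a Moebius map from this half-plane onto the
  disc, the Schwarz lemma gives \<open>\<bar>2 n \<gamma>\<^sub>n\<bar> = \<bar>F'(0)\<bar> \<le> 1\<close>.\<close>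

lemma sum_root_of_unity_powers:
  assumes "n > 0"
  shows "(\<Sum>k<n. (cis (2 * pi / real n) ^ k) ^ m) = (if n dvd m then of_nat n else 0)"
proof -
  define \<zeta> where "\<zeta> = cis (2 * pi / real n) ^ m"
  have sum_eq: "(\<Sum>k<n. (cis (2 * pi / real n) ^ k) ^ m) = (\<Sum>k<n. \<zeta> ^ k)"
    by (simp add: \<zeta>_def mult.commute flip: power_mult)
  have "\<zeta> ^ n = (cis (2 * pi / real n) ^ n) ^ m"
    by (simp add: \<zeta>_def mult.commute flip: power_mult)
  also have "cis (2 * pi / real n) ^ n = 1"
    using assms unfolding Complex.DeMoivre by simp
  finally have \<zeta>n: "\<zeta> ^ n = 1" by simp
  have \<zeta>1: "\<zeta> = 1 \<longleftrightarrow> n dvd m"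
    using complex_root_unity_eq_1[of n m] assms
    by (simp add: \<zeta>_def cis_conv_exp Suc_leI mult_ac flip: exp_of_nat_mult)
  \<comment> \<open>If \<open>n dvd m\<close>, every summand is 1. Otherwise
    \<open>\<zeta> \<noteq> 1\<close>, and the numerator \<open>\<zeta> ^ n - 1\<close> of the
    geometric sum vanishes.\<close>
  show ?thesis
    using \<zeta>1 \<zeta>n unfolding sum_eq by (auto simp: geometric_sum)
qed

text \<open>For \<open>z ^ n = w\<close>, the mean of \<open>p\<close> over the points
  \<open>\<omega> ^ k * z\<close> is a convex combination of values in \<open>S\<close>, and
  root-of-unity cancellation leaves only the exponents divisible by \<open>n\<close>.\<close>

lemma power_series_multiples_in_convex:
  fixes c :: "nat \<Rightarrow> complex"
  assumes "convex S" and "n > 0" and "norm w < 1"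
    and p: "\<And>z. norm z < 1 \<Longrightarrow> (\<lambda>m. c m * z ^ m) sums p z"
    and S: "\<And>z. norm z < 1 \<Longrightarrow> p z \<in> S"
  shows "\<exists>v\<in>S. (\<lambda>k. c (n * k) * w ^ k) sums v"
proof -
  obtain z where z: "z ^ n = w"
    using exists_complex_root[of n w] \<open>n > 0\<close> by blast
  then have "norm z < 1"
    using \<open>norm w < 1\<close> by (metis norm_power not_less one_le_power)
  define \<omega> where "\<omega> = cis (2 * pi / real n)"
  have norm_rot: "norm (\<omega> ^ k * z) < 1" for k
    using \<open>norm z < 1\<close> by (simp add: \<omega>_def norm_mult norm_power)
  define v where "v = (\<Sum>k<n. (1 / real n) *\<^sub>R p (\<omega> ^ k * z))"
  have "v \<in> S"
    unfolding v_def using assms norm_rot by (intro convex_sum) auto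
  have "(\<lambda>m. \<Sum>k<n. (1 / real n) *\<^sub>R (c m * (\<omega> ^ k * z) ^ m)) sums v"
    unfolding v_def by (intro sums_sum sums_scaleR_right p norm_rot)
  moreover have "(\<Sum>k<n. (1 / real n) *\<^sub>R (c m * (\<omega> ^ k * z) ^ m))
      = (if n dvd m then c m * z ^ m else 0)" for m
  proof -
    have "(\<Sum>k<n. (1 / real n) *\<^sub>R (c m * (\<omega> ^ k * z) ^ m))
        = (1 / of_nat n) * (c m * z ^ m) * (\<Sum>k<n. (\<omega> ^ k) ^ m)"
      by (simp add: sum_distrib_left sum_divide_distrib power_mult_distrib scaleR_conv_of_real mult_ac)
    then show ?thesis
      using sum_root_of_unity_powers[OF \<open>n > 0\<close>, of m] \<open>n > 0\<close> by (simp add: \<omega>_def)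
  qed
  ultimately have "(\<lambda>m. if n dvd m then c m * z ^ m else 0) sums v"
    by simp
  \<comment> \<open>The zero terms are dropped by reindexing along the strictly increasing map
    \<open>k \<mapsto> n * k\<close>, whose range is the set of multiples of
    \<open>n\<close>.\<close>
  then have "(\<lambda>k. if n dvd n * k then c (n * k) * z ^ (n * k) else 0) sums v"
    using \<open>n > 0\<close>
    by (subst sums_mono_reindex[where g = "\<lambda>k. n * k"]) (auto simp: strict_mono_def elim: dvdE)
  then have "(\<lambda>k. c (n * k) * w ^ k) sums v"
    by (simp add: power_mult z)
  with \<open>v \<in> S\<close> show ?thesis by blast
qed

lemma norm_deriv_le_1_of_strip:
  fixes F :: "complex \<Rightarrow> complex"
  assumes "0 < \<delta>" and "\<delta> < pi"
    and holF: "F holomorphic_on ball 0 1" and "F 0 = 0"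
    and lo: "\<And>z. norm z < 1 \<Longrightarrow> (\<delta> - pi) / (2 * sin \<delta>) < Re (F z)"
    and hi: "\<And>z. norm z < 1 \<Longrightarrow> Re (F z) < \<delta> / (2 * sin \<delta>)"
  shows "norm (deriv F 0) \<le> 1"
proof -
  have sin: "sin \<delta> > 0" using assms by (intro sin_gt_zero) auto
  \<comment> \<open>The strip has width \<open>pi / (2 * sin \<delta>)\<close>, so the exponential
    in \<open>H\<close> maps it to a half-plane; the factor \<open>a\<close> rotates this onto the
    right half-plane. The Moebius map in \<open>\<phi>\<close> then sends \<open>H 0 = a\<close> to
    0.\<close>
  define a where "a = cis (pi / 2 - \<delta>)"
  have Re_a: "Re a = sin \<delta>" by (simp add: a_def cos_diff)
  have a_sum: "a + cnj a = 2 * complex_of_real (sin \<delta>)"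
    using Re_a by (simp add: complex_add_cnj)
  define H where "H z = a * exp (2 * \<i> * of_real (sin \<delta>) * F z)" for z
  define \<phi> where "\<phi> z = (H z - a) / (H z + cnj a)" for z
  have Re_H: "Re (H z) > 0" if "norm z < 1" for z
  proof -
    \<comment> \<open>An argument of \<open>H z\<close>; the bounds on \<open>Re (F z)\<close> say
      exactly that it lies strictly between \<open>- pi / 2\<close> and
      \<open>pi / 2\<close>.\<close>
    define t where "t = pi / 2 - \<delta> + 2 * sin \<delta> * Re (F z)"
    have "- (pi / 2) < t" "t < pi / 2"
      using lo[OF that] hi[OF that] sin by (auto simp: t_def field_simps)
    then have "cos t > 0" by (intro cos_gt_zero_pi) auto
    moreover have "H z = of_real (exp (- (2 * sin \<delta> * Im (F z)))) * cis t"
      by (simp add: H_def a_def t_def cis_conv_exp exp_of_real flip: exp_add)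
         (simp add: complex_eq_iff algebra_simps Re_exp Im_exp)
    ultimately show ?thesis by simp
  qed
  have den: "H z + cnj a \<noteq> 0" if "norm z < 1" for z
    using Re_H[OF that] Re_a sin by (auto simp: complex_eq_iff)
  have hol: "\<phi> holomorphic_on ball 0 1"
    unfolding \<phi>_def H_def using den by (intro holomorphic_intros holF) (auto simp: H_def)
  have H0: "H 0 = a" by (simp add: H_def \<open>F 0 = 0\<close>)
  have bound: "norm (\<phi> z) < 1" if "norm z < 1" for z
  proof -
    \<comment> \<open>The point \<open>- cnj a\<close> is the mirror image of \<open>a\<close> in
      the imaginary axis, so points of the right half-plane are closer to \<open>a\<close>.\<close>
    have "(norm (H z + cnj a))\<^sup>2 - (norm (H z - a))\<^sup>2 = 4 * Re (H z) * Re a"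
      unfolding cmod_power2 by (simp add: power2_eq_square algebra_simps)
    also have "\<dots> > 0" using Re_H[OF that] Re_a sin by simp
    finally have "norm (H z - a) < norm (H z + cnj a)"
      by (intro power2_less_imp_less[of "norm (H z - a)"]) auto
    then show ?thesis using den[OF that] by (simp add: \<phi>_def norm_divide)
  qed
  have "norm (deriv \<phi> 0) \<le> 1"
    by (rule Schwarz_Lemma(2)[OF hol _ bound, of 0]) (auto simp: \<phi>_def H0)
  \<comment> \<open>The factor \<open>2 * sin \<delta>\<close> from \<open>H\<close> cancels against
    \<open>a + cnj a\<close>, leaving the unimodular factor \<open>\<i> * a\<close>.\<close>
  moreover have "deriv \<phi> 0 = \<i> * a * deriv F 0"
  proof (rule DERIV_imp_deriv)
    have F': "(F has_field_derivative deriv F 0) (at 0)"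
      using holF by (intro holomorphic_derivI[of _ "ball 0 1"]) auto
    have H': "(H has_field_derivative 2 * \<i> * of_real (sin \<delta>) * a * deriv F 0) (at 0)"
      unfolding H_def by (rule derivative_eq_intros F' refl)+ (simp add: \<open>F 0 = 0\<close>)
    show "(\<phi> has_field_derivative \<i> * a * deriv F 0) (at 0)"
      unfolding \<phi>_def using sin
      by (auto intro!: derivative_eq_intros H' simp: H0 a_sum)
  qed
  ultimately show ?thesis by (simp add: norm_mult a_def)
qed

theorem theorem2p6:
  fixes \<delta> :: real and f :: "complex \<Rightarrow> complex" and \<gamma> :: "nat \<Rightarrow> complex"
  assumes "pi / 2 \<le> \<delta>" and "\<delta> < pi"
    and "f \<in> class_M \<delta>"
    and "log_coeffs f \<gamma>"
  shows "\<forall>n\<ge>1. norm (\<gamma> n) \<le> 1 / (2 * real n)"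
proof (intro allI impI)
  fix n :: nat
  assume "n \<ge> 1"
  have disc: "unit_disc = ball 0 1" by (auto simp: unit_disc_def)
  obtain g where holg: "g holomorphic_on ball 0 1"
    and expg: "\<And>z. norm z < 1 \<Longrightarrow> exp (g z) = (if z = 0 then 1 else f z / z)"
    and sums_g: "\<And>z. norm z < 1 \<Longrightarrow> (\<lambda>n. 2 * \<gamma> (Suc n) * z ^ Suc n) sums g z"
    using assms(4) by (auto simp: log_coeffs_def is_log_f_over_z_def disc)
  have f0: "f 0 = 0"
    using assms(3) by (simp add: class_M_def class_A_def)
  have f_eq: "f z = z * exp (g z)" if "norm z < 1" for z
    using expg[OF that] f0 by auto
  have g': "(g has_field_derivative deriv g z) (at z)" if "norm z < 1" for z
    using holg that by (intro holomorphic_derivI[of _ "ball 0 1"]) auto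
  have zdf: "zdf_over_f f z = 1 + z * deriv g z" if z: "norm z < 1" for z
  proof (cases "z = 0")
    case False
    have "((\<lambda>z. z * exp (g z)) has_field_derivative exp (g z) * (1 + z * deriv g z)) (at z)"
      by (auto intro!: derivative_eq_intros g' z simp: algebra_simps)
    then have "(f has_field_derivative exp (g z) * (1 + z * deriv g z)) (at z)"
      by (rule has_field_derivative_transform_within_open[of _ _ _ "ball 0 1"])
        (use z in \<open>auto simp: f_eq\<close>)
    then have "deriv f z = exp (g z) * (1 + z * deriv g z)"
      by (rule DERIV_imp_deriv)
    then show ?thesis using False z by (simp add: zdf_over_f_def f_eq)
  qed (simp add: zdf_over_f_def)
  define c where "c m = 2 * of_nat m * \<gamma> m" for m
  have sums_zg': "(\<lambda>m. c m * z ^ m) sums (z * deriv g z)" if z: "norm z < 1" for z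
  proof -
    \<comment> \<open>\<open>log_coeffs\<close> leaves \<open>\<gamma> 0\<close> arbitrary, so the
      constant coefficient is set to 0 explicitly; in \<open>c\<close> the factor \<open>m\<close>
      does this.\<close>
    define a where "a m = (if m = 0 then 0 else 2 * \<gamma> m)" for m
    have "(\<lambda>m. a m * z ^ m) sums g z" if "norm z < 1" for z
    proof -
      have "(\<lambda>m. a (Suc m) * z ^ Suc m) sums g z"
        using sums_g[OF that] by (simp add: a_def)
      then show ?thesis by (subst (asm) sums_Suc_iff) (simp add: a_def)
    qed
    then have "(\<lambda>m. diffs a m * z ^ m) sums deriv g z"
      using g'[OF z] z by (rule termdiffs_sums_strong)
    then have "(\<lambda>m. z * (diffs a m * z ^ m)) sums (z * deriv g z)"
      by (rule sums_mult)
    also have "(\<lambda>m. z * (diffs a m * z ^ m)) = (\<lambda>m. c (Suc m) * z ^ Suc m)"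
      by (auto simp: diffs_def a_def c_def mult_ac)
    finally show ?thesis by (subst (asm) sums_Suc_iff) (simp add: c_def)
  qed
  \<comment> \<open>The strip of \<open>class_M\<close> shifted by -1, since
    \<open>zdf_over_f f z = 1 + z * deriv g z\<close>.\<close>
  define S where "S = {z. (\<delta> - pi) / (2 * sin \<delta>) < Re z \<and> Re z < \<delta> / (2 * sin \<delta>)}"
  have "convex S"
    unfolding S_def Collect_conj_eq
    by (intro convex_Int convex_halfspace_Re_gt convex_halfspace_Re_lt)
  have in_S: "z * deriv g z \<in> S" if "norm z < 1" for z
    using assms(3) zdf[OF that] that by (force simp: class_M_def S_def unit_disc_def)
  \<comment> \<open>The linear coefficient is \<open>c n = 2 * n * \<gamma> n\<close>, so the claim
    amounts to a bound on \<open>deriv F 0\<close>.\<close>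
  define F where "F w = (\<Sum>k. c (n * k) * w ^ k)" for w
  have F: "(\<lambda>k. c (n * k) * w ^ k) sums F w" "F w \<in> S" if "norm w < 1" for w
    using power_series_multiples_in_convex[OF \<open>convex S\<close> _ that sums_zg' in_S, of n] \<open>n \<ge> 1\<close>
    by (auto simp: F_def sums_iff)
  have holF: "F holomorphic_on ball 0 1"
    by (rule power_series_holomorphic[where a = "\<lambda>k. c (n * k)"]) (auto intro: F)
  have F0: "F 0 = 0" by (simp add: F_def c_def)
  have "(F has_field_derivative deriv F 0) (at 0)"
    using holF by (intro holomorphic_derivI[of _ "ball 0 1"]) auto
  then have "(\<lambda>k. diffs (\<lambda>k. c (n * k)) k * 0 ^ k) sums deriv F 0"
    using F(1) by (intro termdiffs_sums_strong[where K = 1 and f = F]) auto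
  then have "deriv F 0 = c n"
    by (simp add: sums_iff diffs_def)
  moreover have "norm (deriv F 0) \<le> 1"
    using F(2) assms(1,2) pi_gt_zero holF F0
    by (intro norm_deriv_le_1_of_strip[of \<delta>]) (auto simp: S_def simp del: pi_gt_zero)
  ultimately show "norm (\<gamma> n) \<le> 1 / (2 * real n)"
    using \<open>n \<ge> 1\<close> by (simp add: c_def norm_mult field_simps)
qed

end
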